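(* Let $g=\frac1b\sum_{i=1}^b g_i$ on $\mathbb{R}^n$, let $\gamma>0$ be a fixed penalty parameter, and let $D_\sigma:\mathbb{R}^n\to\mathbb{R}^n$ be a denoiser. Assume: (1) each $g_i$ is proper, closed, convex, and Lipschitz continuous on $\mathbb{R}^n$ with constant $L_i>0$, and put $L=\max\{L_1,\dots,L_b\}$; (2) the residual $R_\sigma=I-D_\sigma$ is firmly nonexpansive; (3) $\mathrm{zer}(T)\neq\varnothing$, and there exists $R<\infty$ such that the IPA iterates $x^k$ satisfy $\|x^k-x^*\|_2\le R$ for all $k\ge 0$ and all $x^*\in\mathrm{zer}(T)$. Run IPA for $t\ge 1$ iterations with indices $i_k$ chosen i.i.d. uniformly at random from $\{1,\dots,b\}$. Then the sequence $v^k=z^k-s^{k-1}$ satisfies $$\mathbb{E}\left[\frac1t\sum_{k=1}^t\|S(v^k)\|_2^2\right]\le \frac{(R+2\gamma L)^2}{t}+\max\{\gamma,\gamma^2\}\,C,$$ where $C=4LR+12L^2$.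
   Context: For a proper, closed, convex function $f$ on $\mathbb{R}^n$, $\mathrm{prox}_{\gamma f}(z)=\arg\min_{x\in\mathbb{R}^n}\{\frac12\|x-z\|_2^2+\gamma f(x)\}$. Write $G=\mathrm{prox}_{\gamma g}$ and $G_i=\mathrm{prox}_{\gamma g_i}$; $I$ is the identity operator. IPA (incremental plug-and-play ADMM): given deterministic initial values $x^0,s^0\in\mathbb{R}^n$ and a sequence of indices $i_1,i_2,\dots\in\{1,\dots,b\}$, for $k=1,2,\dots$ set $z^k=G_{i_k}(x^{k-1}+s^{k-1})$, $x^k=D_\sigma(z^k-s^{k-1})$, $s^k=s^{k-1}+x^k-z^k$. $T$ is the set-valued operator $T(x)=\gamma\,\partial g(x)+(D_\sigma^{-1}(x)-x)$, where $\partial g$ is the convex subdifferential and $D_\sigma^{-1}(x)=\{z\in\mathbb{R}^n: x=D_\sigma(z)\}$; $\mathrm{zer}(T)=\{x\in\mathbb{R}^n: 0\in T(x)\}$. The operator $S:\mathbb{R}^n\to\mathbb{R}^n$ is $S=D_\sigma-G(2D_\sigma-I)$, i.e. $S(v)=D_\sigma(v)-G(2D_\sigma(v)-v)$. An operator $N:\mathbb{R}^n\to\mathbb{R}^n$ is firmly nonexpansive if $(Nx-Ny)^{\mathsf T}(x-y)\ge\|Nx-Ny\|_2^2$ for all $x,y\in\mathbb{R}^n$. The constant $R$ is deterministic and the bound in (3) is understood to hold for every realization of the random indices. *)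

theory Defs
  imports "HOL-Probability.Probability"
begin

text \<open>
  Functions are real-valued: they are assumed Lipschitz on all of \<open>\<real>\<^sup>n\<close>, hence finite everywhere,
  and a finite-valued function is proper. Closedness is closedness of the epigraph.
\<close>

definition closed_convex_fun :: "('a::euclidean_space \<Rightarrow> real) \<Rightarrow> bool" where
  "closed_convex_fun f \<longleftrightarrow> convex_on UNIV f \<and> closed (epigraph UNIV f)"

definition prox :: "real \<Rightarrow> ('a::euclidean_space \<Rightarrow> real) \<Rightarrow> 'a \<Rightarrow> 'a" where
  "prox \<gamma> f z = (ARG_MIN (\<lambda>x. 1/2 * (norm (x - z))\<^sup>2 + \<gamma> * f x) x. True)"

definition subdifferential :: "('a::euclidean_space \<Rightarrow> real) \<Rightarrow> 'a \<Rightarrow> 'a set" where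
  "subdifferential f x = {u. \<forall>y. f y \<ge> f x + u \<bullet> (y - x)}"

definition firmly_nonexpansive :: "('a::euclidean_space \<Rightarrow> 'a) \<Rightarrow> bool" where
  "firmly_nonexpansive N \<longleftrightarrow> (\<forall>x y. (N x - N y) \<bullet> (x - y) \<ge> (norm (N x - N y))\<^sup>2)"

definition zer :: "('a \<Rightarrow> 'a::zero set) \<Rightarrow> 'a set" where
  "zer T = {x. 0 \<in> T x}"

text \<open>The set-valued operator \<open>x \<mapsto> \<gamma> \<partial>g(x) + (D\<inverse>(x) - x)\<close> (a Minkowski sum).\<close>

definition pnp_T :: "real \<Rightarrow> ('a::euclidean_space \<Rightarrow> real) \<Rightarrow> ('a \<Rightarrow> 'a) \<Rightarrow> 'a \<Rightarrow> 'a set" where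
  "pnp_T \<gamma> g D x = {\<gamma> *\<^sub>R u + (z - x) | u z. u \<in> subdifferential g x \<and> z \<in> D -` {x}}"

definition pnp_S :: "real \<Rightarrow> ('a::euclidean_space \<Rightarrow> real) \<Rightarrow> ('a \<Rightarrow> 'a) \<Rightarrow> 'a \<Rightarrow> 'a" where
  "pnp_S \<gamma> g D v = D v - prox \<gamma> g (2 *\<^sub>R D v - v)"

text \<open>
  One realization of the incremental plug-and-play ADMM: \<open>\<iota> 1, \<iota> 2, \<dots>\<close> is the index sequence,
  \<open>x0, s0\<close> the initial values. The values \<open>\<iota> 0\<close> and \<open>z 0\<close> are not used.
\<close>

definition ipa_iterates ::
  "real \<Rightarrow> (nat \<Rightarrow> 'a::euclidean_space \<Rightarrow> real) \<Rightarrow> ('a \<Rightarrow> 'a) \<Rightarrow> (nat \<Rightarrow> nat) \<Rightarrow> 'a \<Rightarrow> 'a \<Rightarrow>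
   (nat \<Rightarrow> 'a) \<Rightarrow> (nat \<Rightarrow> 'a) \<Rightarrow> (nat \<Rightarrow> 'a) \<Rightarrow> bool" where
  "ipa_iterates \<gamma> gs D \<iota> x0 s0 x z s \<longleftrightarrow>
     x 0 = x0 \<and> s 0 = s0 \<and>
     (\<forall>k\<ge>1. z k = prox \<gamma> (gs (\<iota> k)) (x (k - 1) + s (k - 1)) \<and>
            x k = D (z k - s (k - 1)) \<and>
            s k = s (k - 1) + x k - z k)"

end

theory Submission
  imports Defs
begin

text \<open>
  The iteration is \<open>v\<^bsup>k+1\<^esup> = v\<^bsup>k\<^esup> - S\<^sub>i(v\<^bsup>k\<^esup>)\<close>, where \<open>S\<^sub>i\<close> is \<open>S\<close> with \<open>g\<close> replaced by \<open>g\<^sub>i\<close>.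
  Each residual \<open>w - prox w\<close> is \<open>\<gamma>\<close> times a subgradient, of norm at most \<open>\<gamma> L\<close>. Hence
  \<open>S\<^sub>i\<close> is within \<open>2 \<gamma> L\<close> of \<open>S\<close>, and \<open>v\<^bsup>k\<^esup>\<close> is within \<open>R + 2 \<gamma> L\<close> of a zero \<open>v\<^sup>*\<close> of \<open>S\<close>.
  As \<open>S\<close> is firmly nonexpansive, each step decreases \<open>\<parallel>v\<^bsup>k\<^esup> - v\<^sup>*\<parallel>\<^sup>2\<close> by at least \<open>\<parallel>S(v\<^bsup>k\<^esup>)\<parallel>\<^sup>2\<close>
  up to an error \<open>4 \<gamma> L (R + 2 \<gamma> L) + 4 \<gamma>\<^sup>2 L\<^sup>2\<close>, and telescoping gives the bound for every
  realization of the indices, not only in expectation.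
\<close>

section \<open>Subgradients and proximal points of Lipschitz convex functions\<close>

text \<open>Testing the subgradient inequality at \<open>x + u\<close> gives
  \<open>(norm u)\<^sup>2 \<le> f (x + u) - f x\<close>, and the Lipschitz bound then cancels one
  factor.\<close>

lemma subgradient_norm_le:
  assumes "L-lipschitz_on UNIV f" "u \<in> subdifferential f x"
  shows "norm u \<le> L"
proof -
  have "norm u * norm u \<le> f (x + u) - f x"
    using assms(2) by (auto simp: subdifferential_def dest: spec[of _ "x + u"]
        simp flip: power2_eq_square power2_norm_eq_inner)
  also have "\<dots> \<le> dist (f (x + u)) (f x)"
    by (simp add: dist_real_def)
  also have "\<dots> \<le> L * dist (x + u) x"
    using assms(1) by (rule lipschitz_onD) auto
  finally have "norm u * norm u \<le> L * norm u"
    by (simp add: dist_norm)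
  then show ?thesis
    using lipschitz_on_nonneg[OF assms(1)] by (cases "u = 0") auto
qed

lemma subdifferential_monotone:
  assumes "u \<in> subdifferential f x" "w \<in> subdifferential f y"
  shows "(u - w) \<bullet> (x - y) \<ge> 0"
proof -
  have "f y \<ge> f x + u \<bullet> (y - x)" "f x \<ge> f y + w \<bullet> (x - y)"
    using assms by (auto simp: subdifferential_def)
  then show ?thesis
    by (simp add: inner_diff_left inner_diff_right)
qed

text \<open>\<open>prox\<close> is defined by a choice operator, so attainment has to come before
  any property of it. Continuity gives a minimizer on a ball around \<open>z\<close>, and points
  outside are no better than \<open>z\<close> itself.\<close>

lemma is_arg_min_prox:
  fixes f :: "'a::euclidean_space \<Rightarrow> real"
  assumes "\<gamma> > 0" "L-lipschitz_on UNIV f"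
  shows "is_arg_min (\<lambda>x. 1/2 * (norm (x - z))\<^sup>2 + \<gamma> * f x) (\<lambda>_. True) (prox \<gamma> f z)"
proof -
  define h where "h x = 1/2 * (norm (x - z))\<^sup>2 + \<gamma> * f x" for x
  \<comment> \<open>At distance \<open>n\<close> from \<open>z\<close> the quadratic term is
    \<open>n\<^sup>2 / 2\<close>, while \<open>\<gamma> * f\<close> can drop by at most
    \<open>\<gamma> * L * n\<close>; the two balance at this radius.\<close>
  define r where "r = 2 * \<gamma> * L"
  have L: "L \<ge> 0" and r: "r \<ge> 0"
    using lipschitz_on_nonneg[OF assms(2)] assms(1) by (auto simp: r_def)
  have "continuous_on UNIV f"
    using assms(2) by (rule lipschitz_on_continuous_on)
  then have "continuous_on (cball z r) h"
    unfolding h_def by (intro continuous_intros) (auto intro: continuous_on_subset)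
  then obtain p where p: "p \<in> cball z r" "\<And>y. y \<in> cball z r \<Longrightarrow> h p \<le> h y"
    using continuous_attains_inf[of "cball z r" h] r by auto
  have "h p \<le> h y" for y
  proof (cases "y \<in> cball z r")
    case False
    then have far: "norm (y - z) \<ge> 2 * \<gamma> * L"
      by (simp add: r_def dist_norm norm_minus_commute)
    have "f z - f y \<le> L * norm (y - z)"
      using lipschitz_onD[OF assms(2), of z y] by (simp add: dist_norm norm_minus_commute)
    then have "\<gamma> * (f z - f y) \<le> \<gamma> * (L * norm (y - z))"
      using assms(1) by simp
    also have "\<dots> = 1/2 * (2 * \<gamma> * L * norm (y - z))"
      by simp
    also have "\<dots> \<le> 1/2 * (norm (y - z))\<^sup>2"
      using mult_right_mono[OF far norm_ge_zero[of "y - z"]] by (simp add: power2_eq_square)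
    finally have "h z \<le> h y"
      by (simp add: h_def algebra_simps)
    moreover have "h p \<le> h z"
      using p(2)[of z] r by simp
    ultimately show ?thesis
      by simp
  qed (use p in auto)
  then have "is_arg_min h (\<lambda>_. True) p"
    by (simp add: is_arg_min_linorder)
  then have "is_arg_min h (\<lambda>_. True) (arg_min h (\<lambda>_. True))"
    unfolding arg_min_def by (rule someI)
  then show ?thesis
    unfolding prox_def h_def .
qed

text \<open>First-order optimality: minimality is tested along the segment from the proximal point
  to \<open>y\<close>, divided by the step length \<open>t\<close>, and the second-order term
  vanishes as \<open>t\<close> tends to 0 from the right.\<close>

lemma prox_residual_subgradient:
  fixes f :: "'a::euclidean_space \<Rightarrow> real"
  assumes "\<gamma> > 0" "L-lipschitz_on UNIV f" "convex_on UNIV f"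
  shows "(1 / \<gamma>) *\<^sub>R (z - prox \<gamma> f z) \<in> subdifferential f (prox \<gamma> f z)"
proof -
  define p where "p = prox \<gamma> f z"
  have min: "1/2 * (norm (p - z))\<^sup>2 + \<gamma> * f p \<le> 1/2 * (norm (y - z))\<^sup>2 + \<gamma> * f y" for y
    using is_arg_min_prox[OF assms(1,2), of z] by (simp add: is_arg_min_linorder p_def)
  have "(z - p) \<bullet> (y - p) \<le> \<gamma> * (f y - f p)" for y
  proof -
    define d where "d = \<gamma> * (f y - f p) - (z - p) \<bullet> (y - p)"
    have "0 \<le> d + t * (1/2 * (norm (y - p))\<^sup>2)" if t: "0 < t" "t < 1" for t :: real
    proof -
      define q where "q = (1 - t) *\<^sub>R p + t *\<^sub>R y"
      have q: "q - z = (p - z) + t *\<^sub>R (y - p)"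
        by (simp add: q_def algebra_simps)
      have "f q \<le> (1 - t) * f p + t * f y"
        unfolding q_def using t by (intro convex_onD[OF assms(3)]) auto
      then have "\<gamma> * f q \<le> \<gamma> * ((1 - t) * f p + t * f y)"
        using assms(1) by simp
      with min[of q] have "1/2 * (norm (p - z))\<^sup>2 + \<gamma> * f p
          \<le> 1/2 * (norm (q - z))\<^sup>2 + \<gamma> * ((1 - t) * f p + t * f y)"
        by simp
      moreover have "(norm (q - z))\<^sup>2
          = (norm (p - z))\<^sup>2 - 2 * t * ((z - p) \<bullet> (y - p)) + t * t * (norm (y - p))\<^sup>2"
        unfolding q by (simp add: power2_norm_eq_inner inner_add_left inner_add_right
            inner_diff_left inner_diff_right inner_commute algebra_simps)
      ultimately have "0 \<le> t * (d + t * (1/2 * (norm (y - p))\<^sup>2))"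
        by (simp add: d_def algebra_simps)
      then show ?thesis
        using t by (simp add: zero_le_mult_iff)
    qed
    then have "\<forall>\<^sub>F t in at_right 0. 0 \<le> d + t * (1/2 * (norm (y - p))\<^sup>2)"
      unfolding eventually_at_right_field by (intro exI[of _ 1]) auto
    moreover have "((\<lambda>t. d + t * (1/2 * (norm (y - p))\<^sup>2)) \<longlongrightarrow> d + 0 * (1/2 * (norm (y - p))\<^sup>2))
        (at_right 0)"
      by (intro tendsto_intros)
    ultimately have "0 \<le> d + 0 * (1/2 * (norm (y - p))\<^sup>2)"
      by (intro tendsto_lowerbound) auto
    then show ?thesis
      by (simp add: d_def)
  qed
  then have "(z - p) \<bullet> (y - p) / \<gamma> \<le> f y - f p" for y
    using assms(1) by (simp add: pos_divide_le_eq mult.commute)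
  then have "f p + (z - p) \<bullet> (y - p) / \<gamma> \<le> f y" for y
    by (simp add: le_diff_eq add.commute)
  then show ?thesis
    by (simp add: subdifferential_def p_def[symmetric])
qed

text \<open>The bound does not depend on \<open>z\<close>, so proximal points of two such functions
  at the same argument differ by at most \<open>2 * \<gamma> * L\<close>.\<close>

lemma prox_eqE:
  fixes f :: "'a::euclidean_space \<Rightarrow> real"
  assumes "\<gamma> > 0" "L-lipschitz_on UNIV f" "convex_on UNIV f"
  obtains u where "u \<in> subdifferential f (prox \<gamma> f z)" "prox \<gamma> f z = z - \<gamma> *\<^sub>R u" "norm u \<le> L"
proof
  let ?u = "(1 / \<gamma>) *\<^sub>R (z - prox \<gamma> f z)"
  show "?u \<in> subdifferential f (prox \<gamma> f z)"
    by (rule prox_residual_subgradient[OF assms])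
  then show "norm ?u \<le> L"
    by (rule subgradient_norm_le[OF assms(2)])
  show "prox \<gamma> f z = z - \<gamma> *\<^sub>R ?u"
    using assms(1) by simp
qed

section \<open>Firm nonexpansiveness of \<open>prox\<close> and \<open>S\<close> relative to a
  reference point\<close>

text \<open>Monotonicity of the subdifferential, with \<open>y\<close> in the role of the proximal
  point of \<open>y + \<gamma> *\<^sub>R u\<close>. Giving \<open>y\<close> by its subgradient
  avoids any appeal to uniqueness of minimizers.\<close>

lemma prox_firm_at:
  fixes f :: "'a::euclidean_space \<Rightarrow> real"
  assumes "\<gamma> > 0" "L-lipschitz_on UNIV f" "convex_on UNIV f" "u \<in> subdifferential f y"
  shows "(prox \<gamma> f w - y) \<bullet> (w - (y + \<gamma> *\<^sub>R u)) \<ge> (norm (prox \<gamma> f w - y))\<^sup>2"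
proof -
  obtain u' where u': "u' \<in> subdifferential f (prox \<gamma> f w)" "prox \<gamma> f w = w - \<gamma> *\<^sub>R u'"
    using prox_eqE[OF assms(1-3)] by blast
  have eq: "w - (y + \<gamma> *\<^sub>R u) = (prox \<gamma> f w - y) + \<gamma> *\<^sub>R (u' - u)"
    by (subst u'(2)) (simp add: algebra_simps)
  have "\<gamma> * ((u' - u) \<bullet> (prox \<gamma> f w - y)) \<ge> 0"
    using subdifferential_monotone[OF u'(1) assms(4)] assms(1) by simp
  then show ?thesis
    unfolding eq by (simp add: inner_add_right power2_norm_eq_inner inner_commute)
qed

text \<open>The point \<open>y\<close> below is a zero of \<open>S\<close>: a zero \<open>D y\<close> of \<open>T\<close> together with its witness in
  \<open>D\<inverse>(D y)\<close>.\<close>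

lemma pnp_S_firm_at:
  fixes f :: "'a::euclidean_space \<Rightarrow> real"
  assumes "\<gamma> > 0" "L-lipschitz_on UNIV f" "convex_on UNIV f"
    and "firmly_nonexpansive (\<lambda>y. y - D y)"
    and "u \<in> subdifferential f (D y)" "y = D y - \<gamma> *\<^sub>R u"
  shows "pnp_S \<gamma> f D v \<bullet> (v - y) \<ge> (norm (pnp_S \<gamma> f D v))\<^sup>2"
proof -
  define a q e where "a = D v - D y" and "q = prox \<gamma> f (2 *\<^sub>R D v - v) - D y" and "e = v - y"
  have S: "pnp_S \<gamma> f D v = a - q"
    by (simp add: pnp_S_def a_def q_def)
  have "D y + \<gamma> *\<^sub>R u = 2 *\<^sub>R D y - y"
    by (subst (3) assms(6)) (simp add: algebra_simps scaleR_2)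
  then have "(2 *\<^sub>R D v - v) - (D y + \<gamma> *\<^sub>R u) = 2 *\<^sub>R a - e"
    by (simp add: a_def e_def algebra_simps)
  then have 1: "q \<bullet> (2 *\<^sub>R a - e) \<ge> (norm q)\<^sup>2"
    using prox_firm_at[OF assms(1-3,5), of "2 *\<^sub>R D v - v"] by (simp add: q_def)
  have "(v - D v) - (y - D y) = e - a"
    by (simp add: a_def e_def)
  then have "(e - a) \<bullet> e \<ge> (norm (e - a))\<^sup>2"
    using assms(4) unfolding firmly_nonexpansive_def by (metis e_def)
  \<comment> \<open>The last inequality amounts to
    \<open>a \<bullet> e \<ge> (norm a)\<^sup>2\<close>. Adding \<open>1\<close> completes the
    square: \<open>(a - q) \<bullet> e \<ge> (norm (a - q))\<^sup>2\<close>.\<close>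
  with 1 show ?thesis
    unfolding S e_def[symmetric]
    by (simp add: power2_norm_eq_inner inner_diff_left inner_diff_right inner_commute algebra_simps)
qed

section \<open>Error recursion along one realization\<close>

text \<open>The exact step to \<open>e - a\<close> does not increase the norm, so it stays within
  \<open>B\<close>, and Cauchy-Schwarz bounds the cross term with the error \<open>d\<close> by
  \<open>\<delta> * B\<close>.\<close>

lemma perturbed_firm_step:
  fixes a d e :: "'a::real_inner"
  assumes "a \<bullet> e \<ge> (norm a)\<^sup>2" "norm d \<le> \<delta>" "norm e \<le> B"
  shows "(norm (e - (a + d)))\<^sup>2 \<le> (norm e)\<^sup>2 - (norm a)\<^sup>2 + 2 * \<delta> * B + \<delta>\<^sup>2"
proof -
  have "(norm (e - a))\<^sup>2 = (norm e)\<^sup>2 - 2 * (a \<bullet> e) + (norm a)\<^sup>2"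
    by (simp add: power2_norm_eq_inner inner_diff_left inner_diff_right inner_commute)
  then have ea: "(norm (e - a))\<^sup>2 \<le> (norm e)\<^sup>2 - (norm a)\<^sup>2"
    using assms(1) by simp
  then have "(norm (e - a))\<^sup>2 \<le> (norm e)\<^sup>2"
    using zero_le_power2[of "norm a"] by linarith
  then have "norm (e - a) \<le> B"
    using assms(3) power2_le_imp_le[of "norm (e - a)" "norm e"] by simp
  then have "norm d * norm (e - a) \<le> \<delta> * B"
    using assms(2) order_trans[OF norm_ge_zero assms(2)] by (intro mult_mono) auto
  moreover have "- (d \<bullet> (e - a)) \<le> norm d * norm (e - a)"
    using Cauchy_Schwarz_ineq2[of d "e - a"] by linarith
  moreover have "(norm d)\<^sup>2 \<le> \<delta>\<^sup>2"
    using assms(2) by (intro power_mono) auto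
  moreover have "(norm (e - (a + d)))\<^sup>2 = (norm (e - a))\<^sup>2 - 2 * (d \<bullet> (e - a)) + (norm d)\<^sup>2"
    by (simp add: power2_norm_eq_inner inner_diff_left inner_diff_right inner_add_left
        inner_add_right inner_commute algebra_simps)
  ultimately show ?thesis
    using ea by linarith
qed

lemma telescope_sum_le:
  fixes e a :: "nat \<Rightarrow> real"
  assumes "\<And>k. k \<ge> 1 \<Longrightarrow> e (Suc k) \<le> e k - a k + c" "\<And>k. e k \<ge> 0"
  shows "(\<Sum>k=1..t. a k) \<le> e 1 + real t * c"
proof -
  have "(\<Sum>k=1..t. a k) \<le> e 1 - e (Suc t) + real t * c"
  proof (induction t)
    case (Suc t)
    then show ?case
      using assms(1)[of "Suc t"] by (simp add: algebra_simps)
  qed simp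
  then show ?thesis
    using assms(2)[of "Suc t"] by linarith
qed

text \<open>A pathwise estimate: the index sequence is fixed, and regularity is asked only of the
  functions it selects, so that it applies outcome by outcome.\<close>

lemma ipa_sum_bound:
  fixes gs :: "nat \<Rightarrow> 'a::euclidean_space \<Rightarrow> real"
  assumes "\<gamma> > 0" and "t \<ge> 1"
    and gs: "\<And>k. k \<ge> 1 \<Longrightarrow> convex_on UNIV (gs (\<iota> k)) \<and> L-lipschitz_on UNIV (gs (\<iota> k))"
    and g: "convex_on UNIV g" "L-lipschitz_on UNIV g"
    and firm: "firmly_nonexpansive (\<lambda>y. y - D y)"
    and ipa: "ipa_iterates \<gamma> gs D \<iota> x0 s0 x z s"
    and "y \<in> zer (pnp_T \<gamma> g D)" "\<And>k. norm (x k - y) \<le> R"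
  shows "1 / real t * (\<Sum>k=1..t. (norm (pnp_S \<gamma> g D (z k - s (k - 1))))\<^sup>2)
    \<le> (R + 2 * \<gamma> * L)\<^sup>2 / real t + max \<gamma> (\<gamma>\<^sup>2) * (4 * L * R + 12 * L\<^sup>2)"
proof -
  define v where "v k = z k - s (k - 1)" for k
  define B where "B = R + 2 * \<gamma> * L"
  define c where "c = 2 * (2 * \<gamma> * L) * B + (2 * \<gamma> * L)\<^sup>2"
  have L: "L \<ge> 0"
    using lipschitz_on_nonneg[OF g(2)] .
  have R: "R \<ge> 0"
    using assms(9)[of 0] norm_ge_zero order_trans by blast
  obtain u y' where u: "u \<in> subdifferential g (D y')" and y: "D y' = y" and y': "y' = D y' - \<gamma> *\<^sub>R u"
  proof -
    obtain u y' where "u \<in> subdifferential g y" "D y' = y" "\<gamma> *\<^sub>R u + (y' - y) = 0"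
      using assms(8) unfolding zer_def pnp_T_def by fastforce
    moreover from this(3) have "y' = y - \<gamma> *\<^sub>R u"
      by (simp add: algebra_simps eq_neg_iff_add_eq_0)
    ultimately show thesis
      using that by auto
  qed
  \<comment> \<open>Hence \<open>y'\<close> is within \<open>\<gamma> * L\<close> of
    \<open>y\<close>, which is half of the margin \<open>2 * \<gamma> * L\<close> in
    \<open>B\<close>; the other half comes from the proximal step.\<close>
  have u_le: "norm u \<le> L"
    using subgradient_norm_le[OF g(2) u] .
  have close: "norm (v k - y') \<le> B" if k: "k \<ge> 1" for k
  proof -
    obtain w where w: "prox \<gamma> (gs (\<iota> k)) (x (k - 1) + s (k - 1))
        = x (k - 1) + s (k - 1) - \<gamma> *\<^sub>R w" "norm w \<le> L"
      using prox_eqE[OF assms(1)] gs[OF k] by metis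
    have "v k = x (k - 1) - \<gamma> *\<^sub>R w"
      using ipa k w(1) by (simp add: ipa_iterates_def v_def)
    then have "v k - y' = (x (k - 1) - y) + (\<gamma> *\<^sub>R u - \<gamma> *\<^sub>R w)"
      using y y' by (simp add: algebra_simps)
    then have "norm (v k - y') \<le> norm (x (k - 1) - y) + norm (\<gamma> *\<^sub>R u - \<gamma> *\<^sub>R w)"
      using norm_triangle_ineq by metis
    also have "norm (\<gamma> *\<^sub>R u - \<gamma> *\<^sub>R w) \<le> norm (\<gamma> *\<^sub>R u) + norm (\<gamma> *\<^sub>R w)"
      by (rule norm_triangle_ineq4)
    also have "\<dots> \<le> \<gamma> * L + \<gamma> * L"
      using assms(1) u_le w(2) by (intro add_mono) auto
    finally show ?thesis
      using assms(9)[of "k - 1"] by (simp add: B_def mult.commute mult.left_commute)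
  qed
  have step: "(norm (v (Suc k) - y'))\<^sup>2 \<le> (norm (v k - y'))\<^sup>2 - (norm (pnp_S \<gamma> g D (v k)))\<^sup>2 + c"
    if k: "k \<ge> 1" for k
  proof -
    define p where "p = 2 *\<^sub>R D (v k) - v k"
    obtain w where w: "prox \<gamma> (gs (\<iota> (Suc k))) p = p - \<gamma> *\<^sub>R w" "norm w \<le> L"
      using prox_eqE[OF assms(1)] gs[of "Suc k"] by (metis le_add1 plus_1_eq_Suc)
    obtain w' where w': "prox \<gamma> g p = p - \<gamma> *\<^sub>R w'" "norm w' \<le> L"
      using prox_eqE[OF assms(1) g(2,1)] by metis
    define d where "d = \<gamma> *\<^sub>R w - \<gamma> *\<^sub>R w'"
    have d_le: "norm d \<le> 2 * \<gamma> * L"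
    proof -
      have "norm d \<le> norm (\<gamma> *\<^sub>R w) + norm (\<gamma> *\<^sub>R w')"
        unfolding d_def by (rule norm_triangle_ineq4)
      also have "\<dots> \<le> \<gamma> * L + \<gamma> * L"
        using assms(1) w(2) w'(2) by (intro add_mono) auto
      finally show ?thesis by (simp add: mult.commute)
    qed
    have xs: "x k = D (v k)" "s k = D (v k) - v k"
      using ipa k by (auto simp: ipa_iterates_def v_def)
    \<comment> \<open>The next proximal step is thus taken at the same argument as the one inside
      \<open>S\<close>, with only the function changed.\<close>
    then have "x k + s k = p"
      by (simp add: p_def scaleR_2)
    then have "v (Suc k) = prox \<gamma> (gs (\<iota> (Suc k))) p - (D (v k) - v k)"
      using ipa xs(2) by (simp add: ipa_iterates_def v_def)
    then have eq: "v (Suc k) - y' = (v k - y') - (pnp_S \<gamma> g D (v k) + d)"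
      using w(1) w'(1) by (simp add: pnp_S_def p_def[symmetric] d_def algebra_simps)
    show ?thesis
      unfolding eq c_def
      using perturbed_firm_step[OF pnp_S_firm_at[OF assms(1) g(2,1) firm u y'] d_le close[OF k]]
      by (simp only: add.assoc)
  qed
  have "(\<Sum>k=1..t. (norm (pnp_S \<gamma> g D (v k)))\<^sup>2) \<le> (norm (v 1 - y'))\<^sup>2 + real t * c"
    by (rule telescope_sum_le) (use step in auto)
  also have "(norm (v 1 - y'))\<^sup>2 \<le> B\<^sup>2"
    using close[of 1] by (intro power_mono) auto
  finally have "1 / real t * (\<Sum>k=1..t. (norm (pnp_S \<gamma> g D (v k)))\<^sup>2)
      \<le> 1 / real t * (B\<^sup>2 + real t * c)"
    by (intro mult_left_mono) auto
  also have "\<dots> = B\<^sup>2 / real t + c"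
    using assms(2) by (simp add: field_simps)
  \<comment> \<open>The linear and quadratic parts in \<open>\<gamma>\<close> are separated here;
    bounding both powers by their maximum produces the constant \<open>C\<close>.\<close>
  also have "c = \<gamma> * (4 * L * R) + \<gamma>\<^sup>2 * (12 * L\<^sup>2)"
    by (simp add: c_def B_def power2_eq_square algebra_simps)
  also have "\<dots> \<le> max \<gamma> (\<gamma>\<^sup>2) * (4 * L * R) + max \<gamma> (\<gamma>\<^sup>2) * (12 * L\<^sup>2)"
    using L R by (intro add_mono mult_right_mono) auto
  finally show ?thesis
    by (simp add: v_def B_def distrib_left)
qed

section \<open>Regularity of the averaged function\<close>

lemma lipschitz_on_average:
  fixes f :: "nat \<Rightarrow> 'a::metric_space \<Rightarrow> real"
  assumes "b \<ge> 1" "\<And>i. i \<in> {1..b} \<Longrightarrow> L-lipschitz_on X (f i)"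
  shows "L-lipschitz_on X (\<lambda>y. 1 / real b * (\<Sum>i=1..b. f i y))"
proof (rule lipschitz_onI)
  show "L \<ge> 0"
    using assms lipschitz_on_nonneg[of L X "f 1"] by auto
next
  fix x y assume xy: "x \<in> X" "y \<in> X"
  have "\<bar>(\<Sum>i=1..b. f i x) - (\<Sum>i=1..b. f i y)\<bar> \<le> (\<Sum>i=1..b. \<bar>f i x - f i y\<bar>)"
    by (simp flip: sum_subtractf)
  also have "\<dots> \<le> (\<Sum>i=1..b. L * dist x y)"
    using lipschitz_onD[OF assms(2) xy] by (intro sum_mono) (auto simp: dist_real_def)
  finally have "\<bar>(\<Sum>i=1..b. f i x) - (\<Sum>i=1..b. f i y)\<bar> \<le> real b * (L * dist x y)"
    by simp
  then show "dist (1 / real b * (\<Sum>i=1..b. f i x)) (1 / real b * (\<Sum>i=1..b. f i y)) \<le> L * dist x y"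
    using assms(1)
    by (simp add: dist_real_def field_simps flip: diff_divide_distrib)
qed

lemma convex_on_average:
  fixes f :: "nat \<Rightarrow> 'a::real_vector \<Rightarrow> real"
  assumes "convex X" "\<And>i. i \<in> {1..b} \<Longrightarrow> convex_on X (f i)"
  shows "convex_on X (\<lambda>y. 1 / real b * (\<Sum>i=1..b. f i y))"
proof -
  have "convex_on X (\<lambda>y. \<Sum>i\<in>I. f i y)" if "finite I" "I \<subseteq> {1..b}" for I
    using that
  proof (induction I)
    case empty
    show ?case
      using assms(1) by (simp add: convex_on_def)
  next
    case (insert i I)
    then show ?case
      using assms(2)[of i] by (auto intro!: convex_on_add)
  qed
  then have "convex_on X (\<lambda>y. \<Sum>i=1..b. f i y)"
    by blast
  then show ?thesis
    by (rule convex_on_cmul[rotated]) simp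
qed

section \<open>From single realizations to the expectation\<close>

theorem theorem1:
  fixes gs :: "nat \<Rightarrow> real ^ 'n \<Rightarrow> real" and g :: "real ^ 'n \<Rightarrow> real"
    and D :: "real ^ 'n \<Rightarrow> real ^ 'n"
    and \<gamma> R L C :: real and Ls :: "nat \<Rightarrow> real" and b t :: nat
    and M :: "'w measure" and \<iota> :: "nat \<Rightarrow> 'w \<Rightarrow> nat"
    and x0 s0 :: "real ^ 'n" and x z s v :: "nat \<Rightarrow> 'w \<Rightarrow> real ^ 'n"
  assumes "b \<ge> 1" and "\<gamma> > 0" and "t \<ge> 1"
    and "g = (\<lambda>y. 1 / real b * (\<Sum>i=1..b. gs i y))"
    and "\<And>i. i \<in> {1..b} \<Longrightarrow> closed_convex_fun (gs i)"
    and "\<And>i. i \<in> {1..b} \<Longrightarrow> Ls i > 0 \<and> (Ls i)-lipschitz_on UNIV (gs i)"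
    and "L = Max (Ls ` {1..b})"
    and "firmly_nonexpansive (\<lambda>y. y - D y)"
    and "prob_space M"
    and "prob_space.indep_vars M (\<lambda>_. count_space {1..b}) \<iota> {1..}"
    and "\<And>k. k \<ge> 1 \<Longrightarrow> distr M (count_space {1..b}) (\<iota> k) = uniform_count_measure {1..b}"
    and "\<And>\<omega>. \<omega> \<in> space M \<Longrightarrow>
           ipa_iterates \<gamma> gs D (\<lambda>k. \<iota> k \<omega>) x0 s0 (\<lambda>k. x k \<omega>) (\<lambda>k. z k \<omega>) (\<lambda>k. s k \<omega>)"
    and "\<And>k \<omega>. k \<ge> 1 \<Longrightarrow> \<omega> \<in> space M \<Longrightarrow> v k \<omega> = z k \<omega> - s (k - 1) \<omega>"
    and "zer (pnp_T \<gamma> g D) \<noteq> {}"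
    and "\<And>\<omega> k y. \<omega> \<in> space M \<Longrightarrow> y \<in> zer (pnp_T \<gamma> g D) \<Longrightarrow> norm (x k \<omega> - y) \<le> R"
    and "C = 4 * L * R + 12 * L\<^sup>2"
  shows "prob_space.expectation M (\<lambda>\<omega>. 1 / real t * (\<Sum>k=1..t. (norm (pnp_S \<gamma> g D (v k \<omega>)))\<^sup>2))
           \<le> (R + 2 * \<gamma> * L)\<^sup>2 / real t + max \<gamma> (\<gamma>\<^sup>2) * C"
proof -
  interpret prob_space M
    by (rule assms(9))
  have lip: "L-lipschitz_on UNIV (gs i)" if "i \<in> {1..b}" for i
  proof (rule lipschitz_on_le)
    show "(Ls i)-lipschitz_on UNIV (gs i)"
      using assms(6)[OF that] by blast
    show "Ls i \<le> L"
      unfolding assms(7) using that by (intro Max_ge) auto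
  qed
  have conv: "convex_on UNIV (gs i)" if "i \<in> {1..b}" for i
    using assms(5)[OF that] by (simp add: closed_convex_fun_def)
  have g: "convex_on UNIV g" "L-lipschitz_on UNIV g"
    unfolding assms(4)
    by (intro convex_on_average convex_UNIV conv lipschitz_on_average assms(1) lip; assumption)+
  \<comment> \<open>Measurability into \<open>count_space {1..b}\<close> places the index in range
    for every outcome, not just almost surely.\<close>
  have idx: "\<iota> k \<omega> \<in> {1..b}" if "k \<ge> 1" "\<omega> \<in> space M" for k \<omega>
  proof -
    have "\<iota> k \<in> measurable M (count_space {1..b})"
      using assms(10) that(1) unfolding indep_vars_def by simp
    from measurable_space[OF this that(2)] show ?thesis
      by simp
  qed
  obtain y where y: "y \<in> zer (pnp_T \<gamma> g D)"
    using assms(14) by auto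
  have bound: "1 / real t * (\<Sum>k=1..t. (norm (pnp_S \<gamma> g D (v k \<omega>)))\<^sup>2)
      \<le> (R + 2 * \<gamma> * L)\<^sup>2 / real t + max \<gamma> (\<gamma>\<^sup>2) * C" if \<omega>: "\<omega> \<in> space M" for \<omega>
  proof -
    have "1 / real t * (\<Sum>k=1..t. (norm (pnp_S \<gamma> g D (z k \<omega> - s (k - 1) \<omega>)))\<^sup>2)
        \<le> (R + 2 * \<gamma> * L)\<^sup>2 / real t + max \<gamma> (\<gamma>\<^sup>2) * (4 * L * R + 12 * L\<^sup>2)"
      by (rule ipa_sum_bound[OF assms(2,3) _ g assms(8) assms(12)[OF \<omega>] y assms(15)[OF \<omega> y]])
        (intro conjI conv lip idx \<omega>; assumption)
    then show ?thesis
      using assms(13) \<omega> assms(16) by simp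
  qed
  show ?thesis
  proof (cases "integrable M (\<lambda>\<omega>. 1 / real t * (\<Sum>k=1..t. (norm (pnp_S \<gamma> g D (v k \<omega>)))\<^sup>2))")
    case True
    then show ?thesis
      by (rule integral_le_const) (use bound in auto)
  next
    case False \<comment> \<open>the expectation is then \<open>0\<close> by convention\<close>
    \<comment> \<open>It remains to see that the right-hand side is nonnegative: at any one outcome
      it dominates a sum of squares.\<close>
    obtain \<omega> where "\<omega> \<in> space M"
      using not_empty by auto
    have "0 \<le> 1 / real t * (\<Sum>k=1..t. (norm (pnp_S \<gamma> g D (v k \<omega>)))\<^sup>2)"
      by (simp add: sum_nonneg)
    also note bound[OF \<open>\<omega> \<in> space M\<close>]
    finally show ?thesis
      unfolding not_integrable_integral_eq[OF False] .
  qed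
qed

end
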